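(* Let $F(\cdot;\theta)$, $\theta\in\Theta$, be an exponential family of the first type with functions $A$ and $B$. Let $n\ge 1$, let $\hat\theta_{MLE,(X_1,\dots,X_n)}=B^{-1}\!\left(\frac{n}{\sum_{i=1}^n A(X_i)}\right)$ be the maximum likelihood estimator of $\theta$ based on a random sample $X_1,\dots,X_n$ of size $n$ from $F(\cdot;\theta)$, and let $\hat\theta_{MLE,(R_1,\dots,R_n)}=B^{-1}\!\left(\frac{n}{A(R_n)}\right)$ be the maximum likelihood estimator of $\theta$ based on the first $n$ upper record values $R_1,\dots,R_n$ from $F(\cdot;\theta)$. Then these two estimators are identically distributed. In other words, if $g$ is a real function, then: (i) $g(\hat\theta_{MLE,(X_1,\dots,X_n)})$ and $g(\hat\theta_{MLE,(R_1,\dots,R_n)})$ have the same distribution; (ii) $MSE\big(g(\hat\theta_{MLE,(X_1,\dots,X_n)})\big)=MSE\big(g(\hat\theta_{MLE,(R_1,\dots,R_n)})\big)$.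
   Context: Exponential family of the first type: the family of distributions with cumulative distribution function $F(x;\theta)=1-\exp\{-B(\theta)A(x)\}$ for $x\in[a,b]$, where $A$ is an increasing differentiable function with $A(a)=0$, $A(b)=+\infty$ ($b=+\infty$ is allowed), and $B(\theta)>0$. The density is $f(x;\theta)=A'(x)B(\theta)\exp\{-A(x)B(\theta)\}$. The parameter set $\Theta\subseteq\mathbb{R}$ is an interval, $B:\Theta\to\mathbb{R}$ is twice differentiable and one-to-one, and $B^{-1}$ is assumed to be defined at the arguments at which it is evaluated. A random sample is an i.i.d. sample. Upper record values: $R_1=X_1$, and subsequent upper records are the successive observations of an i.i.d. sequence from $F(\cdot;\theta)$ that exceed all previous observations. The joint density of the first $n$ upper record values is taken to be $f(r_n;\theta)\prod_{i=1}^{n-1}h(r_i;\theta)=B^n(\theta)\left\{\prod_{i=1}^nA'(r_i)\right\}\exp\{-B(\theta)A(r_n)\}$ for $r_1<\dots<r_n$, where $h=f/(1-F)$; in particular $A(R_n)$ has the Gamma distribution with shape $n$ and scale $1/B(\theta)$. For an estimator $g(\hat\theta)$ of $g(\theta)$, $MSE(g(\hat\theta))=E[(g(\hat\theta)-g(\theta))^2]$, the expectation being under the true parameter $\theta$. *)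

theory Defs
  imports "HOL-Probability.Probability" "HOL-Library.Infinite_Set"
begin

text \<open>
  The function \<open>A\<close> only matters on \<open>[a, b)\<close>, but it is a total function here; \<open>A_borel\<close> merely
  excludes pathological values outside that interval.  Continuity at \<open>a\<close> together with
  differentiability in the interior is implied by (one-sided) differentiability on \<open>[a, b)\<close> and
  also admits Weibull families of shape less than 1.
\<close>

locale exp_family_first_type =
  fixes a :: real and b :: ereal and A :: "real \<Rightarrow> real"
    and \<Theta> :: "real set" and B :: "real \<Rightarrow> real"
  assumes a_less_b: "ereal a < b"
    and A_mono: "mono_on {x. a \<le> x \<and> ereal x < b} A"
    and A_cont: "continuous_on {x. a \<le> x \<and> ereal x < b} A"
    and A_diff: "\<And>x. a < x \<Longrightarrow> ereal x < b \<Longrightarrow> A differentiable (at x)"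
    and A_left: "A a = 0"
    and A_right: "filterlim (A \<circ> real_of_ereal) at_top (at_left b)"
    and A_borel: "A \<in> borel_measurable borel"
    and interval: "is_interval \<Theta>"
    and B_pos: "\<And>\<theta>. \<theta> \<in> \<Theta> \<Longrightarrow> 0 < B \<theta>"
    and B_inj: "inj_on B \<Theta>"
    and B_diff2: "\<exists>B' B''. \<forall>\<theta>\<in>\<Theta>. (B has_real_derivative B' \<theta>) (at \<theta> within \<Theta>) \<and>
                            (B' has_real_derivative B'' \<theta>) (at \<theta> within \<Theta>)"

definition family_cdf ::
    "real \<Rightarrow> ereal \<Rightarrow> (real \<Rightarrow> real) \<Rightarrow> (real \<Rightarrow> real) \<Rightarrow> real \<Rightarrow> real \<Rightarrow> real" where
  "family_cdf a b A B \<theta> x =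
     (if x < a then 0 else if ereal x < b then 1 - exp (- (B \<theta> * A x)) else 1)"

definition iid_with_cdf ::
    "'a measure \<Rightarrow> 'i set \<Rightarrow> ('i \<Rightarrow> 'a \<Rightarrow> real) \<Rightarrow> (real \<Rightarrow> real) \<Rightarrow> bool" where
  "iid_with_cdf M I X F \<longleftrightarrow>
     prob_space M \<and> prob_space.indep_vars M (\<lambda>_. borel) X I \<and>
     (\<forall>i\<in>I. \<forall>x. cdf (distr M borel (X i)) x = F x)"

text \<open>
  Observations and records are numbered from 0, so the \<open>n\<close>-th upper record value \<open>R\<^sub>n\<close> of the
  sequence \<open>y\<close> is \<open>upper_record y (n - 1)\<close>.  If \<open>y\<close> has only finitely many records, the values
  of \<open>upper_record y\<close> from some index on are meaningless; for an i.i.d. sequence with a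
  continuous distribution function this happens with probability 0.
\<close>

definition record_times :: "(nat \<Rightarrow> real) \<Rightarrow> nat set" where
  "record_times y = {j. \<forall>i<j. y i < y j}"

definition upper_record :: "(nat \<Rightarrow> real) \<Rightarrow> nat \<Rightarrow> real" where
  "upper_record y k = y (enumerate (record_times y) k)"

definition sample_mle ::
    "(real \<Rightarrow> real) \<Rightarrow> real set \<Rightarrow> (real \<Rightarrow> real) \<Rightarrow> nat \<Rightarrow> (nat \<Rightarrow> real) \<Rightarrow> real" where
  "sample_mle A \<Theta> B n x = inv_into \<Theta> B (real n / (\<Sum>i<n. A (x i)))"

definition record_mle ::
    "(real \<Rightarrow> real) \<Rightarrow> real set \<Rightarrow> (real \<Rightarrow> real) \<Rightarrow> nat \<Rightarrow> (nat \<Rightarrow> real) \<Rightarrow> real" where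
  "record_mle A \<Theta> B n r = inv_into \<Theta> B (real n / A (r (n - 1)))"

definition identically_distributed ::
    "'a measure \<Rightarrow> ('a \<Rightarrow> real) \<Rightarrow> 'b measure \<Rightarrow> ('b \<Rightarrow> real) \<Rightarrow> bool" where
  "identically_distributed M U N V \<longleftrightarrow>
     U \<in> borel_measurable M \<and> V \<in> borel_measurable N \<and> distr M borel U = distr N borel V"

text \<open>The mean squared error may be infinite, hence the extended nonnegative integral.\<close>

definition MSE :: "'a measure \<Rightarrow> ('a \<Rightarrow> real) \<Rightarrow> real \<Rightarrow> ennreal" where
  "MSE M T t = (\<integral>\<^sup>+\<omega>. ennreal ((T \<omega> - t)\<^sup>2) \<partial>M)"


text \<open>
  The remaining facts are not used to state anything; they confirm that \<open>sample_mle\<close> and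
  \<open>record_mle\<close> maximize the likelihood, i.e. the joint density of the sample and of the first
  \<open>n\<close> upper record values, whenever the inverse of \<open>B\<close> is defined at the argument.
\<close>

definition sample_likelihood ::
    "(real \<Rightarrow> real) \<Rightarrow> (real \<Rightarrow> real) \<Rightarrow> nat \<Rightarrow> (nat \<Rightarrow> real) \<Rightarrow> real \<Rightarrow> real" where
  "sample_likelihood A B n x \<theta> = (\<Prod>i<n. deriv A (x i) * B \<theta> * exp (- (A (x i) * B \<theta>)))"

definition record_likelihood ::
    "(real \<Rightarrow> real) \<Rightarrow> (real \<Rightarrow> real) \<Rightarrow> nat \<Rightarrow> (nat \<Rightarrow> real) \<Rightarrow> real \<Rightarrow> real" where
  "record_likelihood A B n r \<theta> =
     B \<theta> ^ n * (\<Prod>i<n. deriv A (r i)) * exp (- (B \<theta> * A (r (n - 1))))"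

lemma power_exp_le:
  fixes u s :: real
  assumes "0 < u" "0 < s" "1 \<le> n"
  shows "u ^ n * exp (- (u * s)) \<le> (real n / s) ^ n * exp (- (real n / s * s))"
proof -
  define v where "v = u * s / real n"
  have v: "0 < v" using assms by (simp add: v_def)
  have us: "u = real n / s * v" "u * s = real n * v" using assms by (simp_all add: v_def)
  have "v \<le> exp (v - 1)" using exp_ge_add_one_self[of "v - 1"] by simp
  then have "v ^ n \<le> exp (v - 1) ^ n" using v by (intro power_mono) auto
  also have "\<dots> = exp (real n * v - real n)"
    by (simp add: exp_of_nat_mult[symmetric] algebra_simps)
  finally have "v ^ n * exp (- (real n * v)) \<le> exp (- real n)"
    by (simp add: exp_diff exp_minus field_simps)
  then have "(real n / s) ^ n * (v ^ n * exp (- (real n * v))) \<le> (real n / s) ^ n * exp (- real n)"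
    using assms by (intro mult_left_mono) auto
  moreover have "u ^ n = (real n / s) ^ n * v ^ n"
    by (subst us(1)) (rule power_mult_distrib)
  ultimately show ?thesis
    using assms by (simp add: us(2) mult.assoc)
qed

context exp_family_first_type
begin

lemma deriv_A_nonneg:
  assumes "a < x" "ereal x < b"
  shows "0 \<le> deriv A x"
proof -
  have "\<forall>\<^sub>F y in at_right x. ereal y < b"
  proof -
    have "((\<lambda>y. ereal y) \<longlongrightarrow> ereal x) (at_right x)" by (intro tendsto_intros)
    then show ?thesis using order_tendstoD(2) assms(2) by blast
  qed
  then have "\<forall>\<^sub>F y in at_right x. 0 \<le> (A y - A x) / (y - x)"
    using eventually_at_right_less[of x]
  proof eventually_elim
    case (elim y)
    then have "A x \<le> A y" using assms by (intro mono_onD[OF A_mono]) auto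
    then show ?case using elim by simp
  qed
  moreover have "(A has_real_derivative deriv A x) (at x)"
    using A_diff[OF assms] by (simp add: DERIV_deriv_iff_real_differentiable)
  then have "((\<lambda>y. (A y - A x) / (y - x)) \<longlongrightarrow> deriv A x) (at_right x)"
    by (simp add: has_field_derivative_iff filterlim_at_split)
  ultimately show ?thesis
    using tendsto_lowerbound trivial_limit_at_right_real by blast
qed

lemma sample_mle_maximizes:
  assumes "1 \<le> n" "\<And>i. i < n \<Longrightarrow> a < x i \<and> ereal (x i) < b" "0 < (\<Sum>i<n. A (x i))"
    and "real n / (\<Sum>i<n. A (x i)) \<in> B ` \<Theta>"
  shows "sample_mle A \<Theta> B n x \<in> \<Theta> \<and>
         (\<forall>\<theta>\<in>\<Theta>. sample_likelihood A B n x \<theta> \<le> sample_likelihood A B n x (sample_mle A \<Theta> B n x))"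
proof -
  let ?t = "sample_mle A \<Theta> B n x" and ?S = "\<Sum>i<n. A (x i)"
  have t: "?t \<in> \<Theta>" "B ?t = real n / ?S"
    using assms(4) by (auto simp: sample_mle_def inv_into_into f_inv_into_f)
  have L: "sample_likelihood A B n x \<theta> =
      (\<Prod>i<n. deriv A (x i)) * (B \<theta> ^ n * exp (- (B \<theta> * ?S)))" for \<theta>
    by (simp add: sample_likelihood_def prod.distrib exp_sum[symmetric] sum_negf
        sum_distrib_left mult.commute mult.left_commute)
  have "sample_likelihood A B n x \<theta> \<le> sample_likelihood A B n x ?t" if "\<theta> \<in> \<Theta>" for \<theta>
    unfolding L t(2) using assms that
    by (intro mult_left_mono power_exp_le prod_nonneg) (auto simp: B_pos deriv_A_nonneg)
  then show ?thesis using t by blast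
qed

lemma record_mle_maximizes:
  assumes "1 \<le> n" "\<And>i. i < n \<Longrightarrow> a < r i \<and> ereal (r i) < b" "0 < A (r (n - 1))"
    and "real n / A (r (n - 1)) \<in> B ` \<Theta>"
  shows "record_mle A \<Theta> B n r \<in> \<Theta> \<and>
         (\<forall>\<theta>\<in>\<Theta>. record_likelihood A B n r \<theta> \<le> record_likelihood A B n r (record_mle A \<Theta> B n r))"
proof -
  let ?t = "record_mle A \<Theta> B n r" and ?S = "A (r (n - 1))"
  have t: "?t \<in> \<Theta>" "B ?t = real n / ?S"
    using assms(4) by (auto simp: record_mle_def inv_into_into f_inv_into_f)
  have L: "record_likelihood A B n r \<theta> =
      (\<Prod>i<n. deriv A (r i)) * (B \<theta> ^ n * exp (- (B \<theta> * ?S)))" for \<theta>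
    by (simp add: record_likelihood_def)
  have "record_likelihood A B n r \<theta> \<le> record_likelihood A B n r ?t" if "\<theta> \<in> \<Theta>" for \<theta>
    unfolding L t(2) using assms that
    by (intro mult_left_mono power_exp_le prod_nonneg) (auto simp: B_pos deriv_A_nonneg)
  then show ?thesis using t by blast
qed

end

end

theory Submission
  imports Defs "HOL-Real_Asymp.Real_Asymp"
begin

text \<open>
  Under \<open>\<theta>\<close> the variable \<open>A(X)\<close> is exponential with rate \<open>B(\<theta>)\<close>, and, ties having probability 0,
  \<open>A\<close> carries the records of \<open>Y\<close> to the records of \<open>A(Y)\<close>.  So it suffices that the \<open>n\<close>-th record
  of an i.i.d. exponential sequence is distributed like the sum of \<open>n\<close> of its terms.  Let \<open>u k r\<close> be
  the probability that the \<open>k\<close>-th record (from 0) among the values above \<open>r\<close> exists and lies in \<open>C\<close>.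
  Conditioning on the first term \<open>x\<close> gives, with the indicator of \<open>C\<close> for \<open>u (- 1)\<close>,
  \<open>u k r = P(x \<le> r) * u k r + E[u (k - 1) x; x > r]\<close>, which
  by memorylessness becomes \<open>u k r = E[u (k - 1) (r + x)]\<close>, the recursion satisfied by
  \<open>P(r + x\<^sub>0 + \<dots> + x\<^sub>k \<in> C)\<close>.  Both estimators are the same Borel function of the two statistics.
\<close>

section \<open>Enumeration of random sets of indices\<close>

text \<open>The successor step of \<open>enumerate\<close> deletes the least element and enumerates
  what is left, so the induction has to range over all random sets \<open>S\<close>.\<close>

lemma measurable_enumerate:
  assumes "\<And>j::nat. Measurable.pred M (\<lambda>\<omega>. j \<in> S \<omega>)"
  shows "(\<lambda>\<omega>. enumerate (S \<omega>) k) \<in> measurable M (count_space UNIV)"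
  using assms
proof (induction k arbitrary: S)
  case 0
  note [measurable] = 0
  show ?case unfolding enumerate_0 by measurable
next
  case (Suc k)
  note [measurable] = Suc.prems
  show ?case unfolding enumerate_Suc
  proof (rule Suc.IH)
    fix j
    have "Measurable.pred M (\<lambda>\<omega>. j \<in> S \<omega> \<and> (LEAST n. n \<in> S \<omega>) \<noteq> j)" by measurable
    then show "Measurable.pred M (\<lambda>\<omega>. j \<in> S \<omega> - {LEAST n. n \<in> S \<omega>})"
      by (rule back_subst[of "\<lambda>P. P"]) (auto intro!: measurable_cong)
  qed
qed

text \<open>Counting predecessors identifies the element even when \<open>S\<close> is finite, so no
  knowledge of how many records occur is required.\<close>

lemma enumerate_eqI:
  fixes S :: "nat set"
  assumes "j \<in> S" "card (S \<inter> {..<j}) = k"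
  shows "enumerate S k = j"
  using assms
proof (induction k arbitrary: S)
  case 0
  then show ?case by (auto simp: enumerate_0 intro!: Least_equality leI)
next
  case (Suc k)
  let ?m = "LEAST n. n \<in> S"
  obtain i where i: "i \<in> S" "i < j" using Suc.prems(2)
    by (metis Int_iff card.empty lessThan_iff nat.distinct(1) subsetI subset_empty)
  have m: "?m \<in> S" "?m \<le> i" using i by (auto intro: LeastI Least_le)
  have "(S - {?m}) \<inter> {..<j} = S \<inter> {..<j} - {?m}" by auto
  then have "card ((S - {?m}) \<inter> {..<j}) = k" using m i Suc.prems(2) by simp
  then show ?case unfolding enumerate_Suc using m i Suc.prems by (intro Suc.IH) auto
qed

section \<open>Records above a threshold and their recursion on the first term\<close>

text \<open>The threshold plays the role of the record held so far. This closes the recursion: once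
  a first term \<open>x\<close> is read, the rest of the sequence is judged with threshold
  \<open>max r x\<close>.\<close>

definition exceedance_records :: "real \<Rightarrow> (nat \<Rightarrow> real) \<Rightarrow> nat set" where
  "exceedance_records r y = {j. r < y j \<and> (\<forall>i<j. y i < y j)}"

lemma exceedance_records_Stream:
  "exceedance_records r (snth (x ## s)) =
    (if r < x then insert 0 (Suc ` exceedance_records x (snth s))
     else Suc ` exceedance_records r (snth s))"
proof -
  have "j \<in> exceedance_records r (snth (x ## s)) \<longleftrightarrow>
    (case j of 0 \<Rightarrow> r < x | Suc i \<Rightarrow> i \<in> exceedance_records (max r x) (snth s))" for j
    by (cases j) (auto simp: exceedance_records_def All_less_Suc2 Stream_snth less_Suc_eq_0_disj)
  then have "j \<in> exceedance_records r (snth (x ## s)) \<longleftrightarrow>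
    j \<in> (if r < x then {0} else {}) \<union> Suc ` exceedance_records (max r x) (snth s)" for j
    by (cases j) auto
  then show ?thesis by (intro set_eqI) (simp add: max_def)
qed

text \<open>The position is expressed by counting instead of \<open>enumerate\<close>, so that the
  predicate fails on sequences with at most \<open>k\<close> exceedance records and never reads a
  junk value.\<close>

definition kth_record_in :: "nat \<Rightarrow> real set \<Rightarrow> real \<Rightarrow> real stream \<Rightarrow> bool" where
  "kth_record_in k C r s \<longleftrightarrow>
    (\<exists>j \<in> exceedance_records r (snth s).
      card (exceedance_records r (snth s) \<inter> {..<j}) = k \<and> s !! j \<in> C)"

lemma kth_record_in_Stream:
  "kth_record_in k C r (x ## s) \<longleftrightarrow>
    (if r < x then (case k of 0 \<Rightarrow> x \<in> C | Suc k \<Rightarrow> kth_record_in k C x s)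
     else kth_record_in k C r s)"
proof -
  have S: "insert 0 (Suc ` S) \<inter> {..<Suc j} = insert 0 (Suc ` (S \<inter> {..<j}))"
    "Suc ` S \<inter> {..<Suc j} = Suc ` (S \<inter> {..<j})" for S j by auto
  show ?thesis
    unfolding kth_record_in_def exceedance_records_Stream
    by (cases k) (auto simp: S card_image card_insert_if)
qed

lemma measurable_kth_record_in [measurable]:
  assumes [measurable]: "C \<in> sets borel"
  shows "Measurable.pred (stream_space borel) (kth_record_in k C r)"
  unfolding kth_record_in_def exceedance_records_def Bex_def
  by measurable

section \<open>Memorylessness, Borel inverses and comparison of probability laws\<close>

text \<open>Translate by \<open>r\<close>; the density at \<open>r + x\<close> then factors into
  \<open>exp (- l * r)\<close> and the density at \<open>x\<close>.\<close>

lemma exponential_memoryless: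
  fixes l r :: real
  assumes l: "0 < l" and r: "0 \<le> r" and g[measurable]: "g \<in> borel_measurable borel"
  shows "(\<integral>\<^sup>+x. g x * indicator {r<..} x \<partial>density lborel (exponential_density l)) =
    ennreal (exp (- l * r)) * (\<integral>\<^sup>+x. g (r + x) \<partial>density lborel (exponential_density l))"
proof -
  have "(\<integral>\<^sup>+x. g x * indicator {r<..} x \<partial>density lborel (exponential_density l)) =
     (\<integral>\<^sup>+x. ennreal (exponential_density l x) * (g x * indicator {r<..} x) \<partial>lborel)"
    by (simp add: nn_integral_density)
  also have "\<dots> = (\<integral>\<^sup>+x. ennreal (exponential_density l (r + x)) *
      (g (r + x) * indicator {r<..} (r + x)) \<partial>lborel)"
    by (subst nn_integral_real_affine[where c = 1 and t = r]) auto
  also have "\<dots> = (\<integral>\<^sup>+x. ennreal (exp (- l * r)) * (ennreal (exponential_density l x) * g (r + x)) \<partial>lborel)"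
  proof (rule nn_integral_cong_AE)
    \<comment> \<open>The point 0 has to be removed: there the open ray \<open>{r<..}\<close>
      already excludes \<open>r + x\<close>, while the density still has the value
      \<open>l\<close>.\<close>
    show "AE x in lborel. ennreal (exponential_density l (r + x)) * (g (r + x) * indicator {r<..} (r + x)) =
      ennreal (exp (- l * r)) * (ennreal (exponential_density l x) * g (r + x))"
      using AE_lborel_singleton[of 0]
    proof eventually_elim
      case (elim x)
      have "exponential_density l (r + x) = exp (- l * r) * exponential_density l x" if "0 < x"
        using that r by (simp add: exponential_density_def exp_add[symmetric] algebra_simps)
      then show ?case using elim l r
        by (cases "0 < x") (auto simp: exponential_density_def ennreal_mult mult_ac)
    qed
  qed
  also have "\<dots> = ennreal (exp (- l * r)) * (\<integral>\<^sup>+x. g (r + x) \<partial>density lborel (exponential_density l))"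
    by (simp add: nn_integral_density nn_integral_cmult)
  finally show ?thesis .
qed

text \<open>On the image of \<open>f\<close>, a sublevel set of the inverse is the image of the
  interval \<open>I \<inter> {..c}\<close>. Continuous images of intervals are intervals, hence
  Borel.\<close>

lemma borel_measurable_inv_into_interval:
  fixes f :: "real \<Rightarrow> real"
  assumes I: "is_interval I" and cont: "continuous_on I f" and inj: "inj_on f I"
  shows "inv_into I f \<in> borel_measurable borel"
proof (rule borel_measurable_iff_le[THEN iffD2], intro allI)
  fix c
  define d where "d = (SOME x::real. False)"
  have im[measurable]: "f ` (I \<inter> J) \<in> sets borel" if "is_interval J" for J
  proof -
    have "is_interval (I \<inter> J)" using I that by (simp add: is_interval_Int)
    then have "connected (f ` (I \<inter> J))"
      by (intro connected_continuous_image continuous_on_subset[OF cont])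
        (auto simp: is_interval_connected_1)
    then show ?thesis by (intro real_interval_borel_measurable) (simp add: is_interval_connected_1)
  qed
  \<comment> \<open>Outside the image of \<open>f\<close>, \<^const>\<open>inv_into\<close> takes one constant junk value.\<close>
  have d: "inv_into I f y = d" if "y \<notin> f ` I" for y
    using that unfolding inv_into_def d_def by (intro arg_cong[where f = Eps]) auto
  have "{y. inv_into I f y \<le> c} = f ` (I \<inter> {..c}) \<union> (if d \<le> c then - f ` (I \<inter> UNIV) else {})"
  proof (rule set_eqI)
    fix y
    show "y \<in> {y. inv_into I f y \<le> c} \<longleftrightarrow>
        y \<in> f ` (I \<inter> {..c}) \<union> (if d \<le> c then - f ` (I \<inter> UNIV) else {})"
      by (cases "y \<in> f ` I") (auto simp: d inj)
  qed
  also have "\<dots> \<in> sets borel" using im[of "{..c}"] im[of UNIV] by (auto simp: is_interval_ic)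
  finally show "{w \<in> space borel. inv_into I f w \<le> c} \<in> sets borel" by simp
qed

text \<open>The inequality for the complement of \<open>C\<close> reverses the one for
  \<open>C\<close>, as both total masses are 1. Thus a one-sided estimate will identify the law of a
  record, without a separate proof that the record exists almost surely.\<close>

lemma prob_space_eqI_le:
  assumes "prob_space P" "prob_space Q" and sets: "sets P = sets Q"
    and le: "\<And>C. C \<in> sets P \<Longrightarrow> emeasure P C \<le> emeasure Q C"
  shows "P = Q"
proof (rule measure_eqI[OF sets])
  fix C assume C: "C \<in> sets P"
  interpret P: prob_space P by fact
  interpret Q: prob_space Q by fact
  have sp: "space P = space Q" using sets by (rule sets_eq_imp_space_eq)
  have "measure P C \<le> measure Q C" "measure P (space P - C) \<le> measure Q (space P - C)"
    using le[OF C] le[of "space P - C"] C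
    by (auto simp: P.emeasure_eq_measure Q.emeasure_eq_measure)
  then show "emeasure P C = emeasure Q C"
    using C P.prob_compl[of C] Q.prob_compl[of C] sets sp
    by (simp add: P.emeasure_eq_measure Q.emeasure_eq_measure)
qed

section \<open>The law of exponential records on stream space\<close>

lemma kth_record_in_law:
  fixes l :: real
  defines "\<nu> \<equiv> density lborel (exponential_density l)"
  assumes l: "0 < l" and C[measurable]: "C \<in> sets borel" and "0 \<le> r"
  shows "(\<integral>\<^sup>+s. indicator {s. kth_record_in k C r s} s \<partial>stream_space \<nu>) =
    (\<integral>\<^sup>+s. indicator C (r + (\<Sum>i<Suc k. s !! i)) \<partial>stream_space \<nu>)"
  using \<open>0 \<le> r\<close>
proof (induction k arbitrary: r rule: less_induct)
  case (less k)
  \<comment> \<open>The index is shifted: \<open>v k\<close> has \<open>k\<close> summands, so the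
    goal is \<open>u k r = v (Suc k) r\<close>. In particular \<open>v 0 x\<close> is the indicator
    of \<open>C\<close> at \<open>x\<close>, which starts the recursion.\<close>
  define u where "u k r = (\<integral>\<^sup>+s. indicator {s. kth_record_in k C r s} s \<partial>stream_space \<nu>)" for k r
  define v where "v k r = (\<integral>\<^sup>+s. indicator C (r + (\<Sum>i<k. s !! i)) \<partial>stream_space \<nu>)" for k r
  interpret \<nu>: prob_space \<nu> unfolding \<nu>_def by (rule prob_space_exponential_density[OF l])
  interpret S: prob_space "stream_space \<nu>" by (rule \<nu>.prob_space_stream_space)
  have [measurable_cong]: "sets \<nu> = sets borel" by (simp add: \<nu>_def)
  have [measurable]: "v k \<in> borel_measurable borel" for k
    unfolding v_def by measurable
  have u_fin: "u k r \<le> 1" and v_fin: "v k r \<le> 1" for k r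
    unfolding u_def v_def by (auto intro!: S.nn_integral_le_const split: split_indicator)
  have v_Suc: "v (Suc k) r = (\<integral>\<^sup>+x. v k (r + x) \<partial>\<nu>)" for k r
    unfolding v_def
    by (subst \<nu>.nn_integral_stream_space)
      (simp_all add: sum.lessThan_Suc_shift add.assoc del: sum.lessThan_Suc)
  \<comment> \<open>A first term \<open>x\<close> not above \<open>r\<close> is skipped. Otherwise
    it becomes the new threshold, nonnegative like \<open>r\<close>, and the induction hypothesis
    applies to it.\<close>
  have "(\<integral>\<^sup>+s. indicator {s. kth_record_in k C r s} (x ## s) \<partial>stream_space \<nu>) =
      u k r * indicator {..r} x + v k x * indicator {r<..} x" for x
  proof (cases "r < x")
    case True
    show ?thesis
    proof (cases k)
      case 0
      then show ?thesis using True
        by (simp add: v_def u_def kth_record_in_Stream indicator_def S.emeasure_space_1)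
    next
      case (Suc k')
      then have "u k' x = v k x" using True less by (auto simp: u_def v_def)
      then show ?thesis using True Suc by (simp add: u_def kth_record_in_Stream indicator_def)
    qed
  qed (simp add: u_def kth_record_in_Stream indicator_def)
  then have "u k r = (\<integral>\<^sup>+x. u k r * indicator {..r} x + v k x * indicator {r<..} x \<partial>\<nu>)"
    by (subst u_def, subst \<nu>.nn_integral_stream_space) simp_all
  also have "\<dots> = u k r * emeasure \<nu> {..r} + (\<integral>\<^sup>+x. v k x * indicator {r<..} x \<partial>\<nu>)"
    by (simp add: nn_integral_add nn_integral_cmult)
  also have "emeasure \<nu> {..r} = ennreal (1 - exp (- l * r))"
    unfolding \<nu>_def using l less.prems
    by (subst emeasure_erlang_density) (simp_all add: erlang_CDF_0 mult.commute)
  also have "(\<integral>\<^sup>+x. v k x * indicator {r<..} x \<partial>\<nu>) = ennreal (exp (- l * r)) * v (Suc k) r"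
    unfolding \<nu>_def using l less.prems
    by (subst exponential_memoryless) (simp_all add: v_Suc flip: \<nu>_def)
  finally have eq: "u k r = u k r * ennreal (1 - exp (- l * r)) + ennreal (exp (- l * r)) * v (Suc k) r" .
  \<comment> \<open>The unknown \<open>u k r\<close> occurs on both sides. Since both quantities are
    at most 1, the equation can be moved to the reals, where subtraction leaves the positive factor
    \<open>exp (- l * r)\<close> to cancel.\<close>
  obtain x where x: "u k r = ennreal x" "0 \<le> x" using u_fin[of k r]
    by (cases "u k r") (auto simp: top_unique)
  obtain y where y: "v (Suc k) r = ennreal y" "0 \<le> y" using v_fin[of "Suc k" r]
    by (cases "v (Suc k) r") (auto simp: top_unique)
  have "ennreal x = ennreal (x * (1 - exp (- l * r)) + exp (- l * r) * y)"
    using eq x y l less.prems by (simp add: ennreal_mult' ennreal_plus)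
  then have "x = x * (1 - exp (- l * r)) + exp (- l * r) * y"
    using x y l less.prems by (subst (asm) ennreal_inj) auto
  then have "exp (- l * r) * x = exp (- l * r) * y" by (simp add: algebra_simps)
  then have "u k r = v (Suc k) r" using x y by simp
  then show ?case unfolding u_def v_def .
qed

section \<open>Transfer from streams to independent random variables\<close>

lemma (in prob_space) distr_to_stream_indep_vars:
  assumes ind: "indep_vars (\<lambda>_. borel) Z (UNIV :: nat set)"
    and law: "\<And>i. distr M borel (Z i) = \<nu>"
  shows "distr M (stream_space \<nu>) (\<lambda>\<omega>. to_stream (\<lambda>i. Z i \<omega>)) = stream_space \<nu>"
proof -
  have rv[measurable]: "\<And>i. random_variable borel (Z i)" using ind by (auto simp: indep_vars_def)
  have [measurable_cong]: "sets \<nu> = sets borel" using law[of 0] by auto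
  have PiM: "distr M (\<Pi>\<^sub>M i\<in>UNIV. borel) (\<lambda>\<omega> i. Z i \<omega>) = (\<Pi>\<^sub>M i\<in>UNIV. \<nu>)"
    using ind indep_vars_iff_distr_eq_PiM'[of UNIV Z "\<lambda>_. borel"] by (simp add: law restrict_def)
  have "stream_space \<nu> = distr (\<Pi>\<^sub>M i\<in>UNIV. \<nu>) (stream_space \<nu>) to_stream"
    by (rule stream_space_eq_distr)
  also have "\<dots> = distr M (stream_space \<nu>) (to_stream \<circ> (\<lambda>\<omega> i. Z i \<omega>))"
    unfolding PiM[symmetric]
  proof (rule distr_distr)
    show "(\<lambda>\<omega> i. Z i \<omega>) \<in> measurable M (\<Pi>\<^sub>M i\<in>UNIV. borel)"
      by (rule measurable_PiM_single') (auto simp: space_PiM)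
  qed measurable
  finally show ?thesis by (simp add: comp_def)
qed

lemma (in prob_space) distr_sum_indep_vars_stream:
  fixes Z :: "nat \<Rightarrow> 'a \<Rightarrow> real"
  assumes ind: "indep_vars (\<lambda>_. borel) Z {..<n}" and n: "0 < n"
    and law: "\<And>i. i < n \<Longrightarrow> distr M borel (Z i) = \<nu>"
  shows "distr M borel (\<lambda>\<omega>. \<Sum>i<n. Z i \<omega>) = distr (stream_space \<nu>) borel (\<lambda>s. \<Sum>i<n. s !! i)"
proof -
  have rv[measurable]: "\<And>i. i < n \<Longrightarrow> random_variable borel (Z i)" using ind by (auto simp: indep_vars_def)
  have [measurable_cong]: "sets \<nu> = sets borel" using law[OF n] by auto
  have PiM: "distr M (\<Pi>\<^sub>M i\<in>{..<n}. borel) (\<lambda>\<omega>. \<lambda>i\<in>{..<n}. Z i \<omega>) = (\<Pi>\<^sub>M i\<in>{..<n}. \<nu>)"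
    using ind n indep_vars_iff_distr_eq_PiM'[of "{..<n}" Z "\<lambda>_. borel"]
      PiM_cong[of "{..<n}" "{..<n}" "\<lambda>i. distr M borel (Z i)" "\<lambda>_. \<nu>"]
    by (auto simp: law lessThan_empty_iff)
  interpret \<nu>: prob_space \<nu> using law[OF n] rv[OF n] prob_space_distr by metis
  interpret P: product_prob_space "\<lambda>_. \<nu>" "UNIV :: nat set" ..
  have "distr M borel (\<lambda>\<omega>. \<Sum>i<n. Z i \<omega>) =
      distr (distr M (\<Pi>\<^sub>M i\<in>{..<n}. borel) (\<lambda>\<omega>. \<lambda>i\<in>{..<n}. Z i \<omega>)) borel (\<lambda>z. \<Sum>i<n. z i)"
    by (subst distr_distr) (auto simp: comp_def intro!: distr_cong)
  \<comment> \<open>Only \<open>n\<close> variables are given on \<open>M\<close>, so no stream can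
    be built from them. Instead their joint law is recognised as a marginal of the infinite
    product.\<close>
  also have "\<dots> = distr (distr (PiM UNIV (\<lambda>_. \<nu>)) (PiM {..<n} (\<lambda>_. \<nu>))
      (\<lambda>x. restrict x {..<n})) borel (\<lambda>z. \<Sum>i<n. z i)"
    unfolding PiM by (subst P.distr_PiM_restrict_finite) auto
  also have "\<dots> = distr (PiM UNIV (\<lambda>_. \<nu>)) borel (\<lambda>z. \<Sum>i<n. z i)"
    by (subst distr_distr) (auto simp: comp_def intro!: distr_cong)
  also have "\<dots> = distr (stream_space \<nu>) borel (\<lambda>s. \<Sum>i<n. s !! i)"
    by (subst stream_space_eq_distr, subst distr_distr) (auto simp: comp_def to_stream_def)
  finally show ?thesis .
qed

lemma borel_measurable_upper_record:
  assumes Z[measurable]: "\<And>i. Z i \<in> borel_measurable M"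
  shows "(\<lambda>\<omega>. upper_record (\<lambda>i. Z i \<omega>) k) \<in> borel_measurable M"
proof -
  have "(\<lambda>\<omega>. enumerate (record_times (\<lambda>i. Z i \<omega>)) k) \<in> measurable M (count_space UNIV)"
    by (rule measurable_enumerate) (simp add: record_times_def)
  then show ?thesis
    unfolding upper_record_def by (rule measurable_compose_countable[rotated]) simp
qed

lemma (in prob_space) distr_upper_record_exponential:
  fixes Z :: "nat \<Rightarrow> 'a \<Rightarrow> real" and l :: real
  defines "\<nu> \<equiv> density lborel (exponential_density l)"
  assumes l: "0 < l" and ind: "indep_vars (\<lambda>_. borel) Z UNIV"
    and law: "\<And>i. distr M borel (Z i) = \<nu>"
  shows "distr M borel (\<lambda>\<omega>. upper_record (\<lambda>i. Z i \<omega>) k) =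
    distr (stream_space \<nu>) borel (\<lambda>s. \<Sum>i<Suc k. s !! i)"
proof (rule prob_space_eqI_le[symmetric])
  interpret \<nu>: prob_space \<nu> unfolding \<nu>_def by (rule prob_space_exponential_density[OF l])
  interpret S: prob_space "stream_space \<nu>" by (rule \<nu>.prob_space_stream_space)
  have [measurable_cong]: "sets \<nu> = sets borel" by (simp add: \<nu>_def)
  have rv[measurable]: "\<And>i. random_variable borel (Z i)" using ind by (auto simp: indep_vars_def)
  note borel_measurable_upper_record[OF rv, measurable]
  show "prob_space (distr M borel (\<lambda>\<omega>. upper_record (\<lambda>i. Z i \<omega>) k))"
    by (rule prob_space_distr) measurable
  show "prob_space (distr (stream_space \<nu>) borel (\<lambda>s. \<Sum>i<Suc k. s !! i))"
    by (rule S.prob_space_distr) measurable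
  \<comment> \<open>With all terms positive, the records above threshold 0 are exactly the records,
    including the first term.\<close>
  have pos: "AE \<omega> in M. \<forall>i. 0 < Z i \<omega>"
  proof (subst AE_all_countable, intro allI)
    fix i
    have "AE x in \<nu>. 0 < x"
      unfolding \<nu>_def using AE_lborel_singleton[of 0]
      by (subst AE_density) (auto simp: exponential_density_def)
    then show "AE \<omega> in M. 0 < Z i \<omega>" unfolding law[of i, symmetric] by (subst (asm) AE_distr_iff) auto
  qed
  fix C assume "C \<in> sets (distr (stream_space \<nu>) borel (\<lambda>s. \<Sum>i<Suc k. s !! i))"
  then have [measurable]: "C \<in> sets borel" by simp
  have "emeasure (distr (stream_space \<nu>) borel (\<lambda>s. \<Sum>i<Suc k. s !! i)) C =
      (\<integral>\<^sup>+s. indicator C (0 + (\<Sum>i<Suc k. s !! i)) \<partial>stream_space \<nu>)"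
    by (subst nn_integral_indicator[symmetric]) (simp_all add: nn_integral_distr del: nn_integral_indicator)
  also have "\<dots> = (\<integral>\<^sup>+s. indicator {s. kth_record_in k C 0 s} s \<partial>stream_space \<nu>)"
    unfolding \<nu>_def by (rule kth_record_in_law[OF l, symmetric]) auto
  also have "\<dots> = (\<integral>\<^sup>+s. indicator {s. kth_record_in k C 0 s} s
      \<partial>distr M (stream_space \<nu>) (\<lambda>\<omega>. to_stream (\<lambda>i. Z i \<omega>)))"
    by (simp add: distr_to_stream_indep_vars[OF ind law])
  also have "\<dots> = (\<integral>\<^sup>+\<omega>. indicator {s. kth_record_in k C 0 s} (to_stream (\<lambda>i. Z i \<omega>)) \<partial>M)"
  proof (rule nn_integral_distr)
    show "(\<lambda>\<omega>. to_stream (\<lambda>i. Z i \<omega>)) \<in> measurable M (stream_space \<nu>)"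
      by (rule measurable_stream_space2) (simp add: to_stream_def)
  qed simp
  \<comment> \<open>Only an inequality, since the left-hand side ignores sequences with too few records.\<close>
  also have "\<dots> \<le> (\<integral>\<^sup>+\<omega>. indicator C (upper_record (\<lambda>i. Z i \<omega>) k) \<partial>M)"
    using pos
  proof (intro nn_integral_mono_AE, eventually_elim)
    case (elim \<omega>)
    have "snth (to_stream (\<lambda>i. Z i \<omega>)) = (\<lambda>i. Z i \<omega>)" by (simp add: to_stream_def fun_eq_iff)
    moreover have "exceedance_records 0 (\<lambda>i. Z i \<omega>) = record_times (\<lambda>i. Z i \<omega>)"
      using elim by (auto simp: exceedance_records_def record_times_def)
    ultimately show ?case
      by (auto simp: kth_record_in_def upper_record_def enumerate_eqI split: split_indicator)
  qed
  also have "\<dots> = emeasure (distr M borel (\<lambda>\<omega>. upper_record (\<lambda>i. Z i \<omega>) k)) C"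
    by (subst nn_integral_indicator[symmetric]) (simp_all add: nn_integral_distr del: nn_integral_indicator)
  finally show "emeasure (distr (stream_space \<nu>) borel (\<lambda>s. \<Sum>i<Suc k. s !! i)) C \<le>
      emeasure (distr M borel (\<lambda>\<omega>. upper_record (\<lambda>i. Z i \<omega>) k)) C" .
qed simp

text \<open>The joint law is a product, so it suffices to fix the value of \<open>U\<close>; the law
  of \<open>V\<close> gives that single point mass 0.\<close>

lemma (in prob_space) indep_var_AE_neq:
  fixes U V :: "'a \<Rightarrow> real"
  assumes ind: "indep_var borel U borel V" and cont: "\<And>x. emeasure (distr M borel V) {x} = 0"
  shows "AE \<omega> in M. U \<omega> \<noteq> V \<omega>"
proof -
  have [measurable]: "random_variable borel U" "random_variable borel V"
    and pair: "distr M borel U \<Otimes>\<^sub>M distr M borel V = distr M (borel \<Otimes>\<^sub>M borel) (\<lambda>x. (U x, V x))"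
    using ind by (auto simp: indep_var_distribution_eq)
  interpret U: prob_space "distr M borel U" by (rule prob_space_distr) simp
  interpret V: prob_space "distr M borel V" by (rule prob_space_distr) simp
  interpret pair_sigma_finite "distr M borel U" "distr M borel V" ..
  have "AE p in distr M borel U \<Otimes>\<^sub>M distr M borel V. fst p \<noteq> snd p"
  proof (rule AE_pair_measure)
    show "AE x in distr M borel U. AE y in distr M borel V. fst (x, y) \<noteq> snd (x, y)"
      using cont by (intro AE_I2 AE_I[where N = "{_}"]) auto
  qed measurable
  then show ?thesis unfolding pair by (subst (asm) AE_distr_iff) auto
qed

lemma (in prob_space) indep_vars_imp_indep_var:
  assumes "indep_vars (\<lambda>_. N) X I" "i \<in> I" "j \<in> I" "i \<noteq> j"
  shows "indep_var N (X i) N (X j)"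
proof -
  have "indep_var N ((\<lambda>f. f i) \<circ> (\<lambda>\<omega>. restrict (\<lambda>i. X i \<omega>) {i}))
      N ((\<lambda>f. f j) \<circ> (\<lambda>\<omega>. restrict (\<lambda>i. X i \<omega>) {j}))"
    using assms by (intro indep_var_compose[OF indep_var_restrict[OF assms(1)]]) auto
  then show ?thesis by (simp add: comp_def)
qed

section \<open>The law of A(X) in the exponential family\<close>

text \<open>Intermediate value theorem between \<open>a\<close>, where \<open>A\<close> vanishes,
  and a point near \<open>b\<close> where \<open>A\<close> is at least \<open>t\<close>. As
  \<open>A\<close> may have flat stretches, \<open>c\<close> is just some preimage and serves as a
  quantile below.\<close>

lemma (in exp_family_first_type) A_surj:
  assumes "0 \<le> t"
  obtains c where "a \<le> c" "ereal c < b" "A c = t"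
proof -
  have "\<forall>\<^sub>F e in at_left b. t \<le> (A \<circ> real_of_ereal) e"
    using A_right by (simp add: filterlim_at_top)
  then obtain d where d: "d < b" "\<And>e. d < e \<Longrightarrow> e < b \<Longrightarrow> t \<le> A (real_of_ereal e)"
    unfolding eventually_at_left[OF a_less_b] by auto
  obtain e where "max d (ereal a) < e" "e < b" using dense[of "max d (ereal a)" b] d a_less_b by auto
  then have "t \<le> A (real_of_ereal e)" "ereal a < e" "e < b" using d by auto
  then obtain x where x: "t \<le> A x" "a < x" "ereal x < b" by (cases e) auto
  have "continuous_on {a..x} A"
    by (rule continuous_on_subset[OF A_cont]) (use x in \<open>auto intro: le_less_trans[of _ "ereal x"]\<close>)
  then obtain c where "a \<le> c" "c \<le> x" "A c = t"
    using IVT'[of A a t x] x assms A_left by auto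
  moreover have "ereal c < b" using \<open>c \<le> x\<close> x(3) by (metis ereal_less_eq(3) le_less_trans)
  ultimately show thesis using that by blast
qed

lemma (in exp_family_first_type)
  assumes "\<theta> \<in> \<Theta>" and "prob_space M" and X[measurable]: "X \<in> borel_measurable M"
    and law: "\<And>x. cdf (distr M borel X) x = family_cdf a b A B \<theta> x"
  shows AE_in_support: "AE \<omega> in M. a < X \<omega> \<and> ereal (X \<omega>) < b"
    and distr_A_exponential: "distr M borel (\<lambda>\<omega>. A (X \<omega>)) = density lborel (exponential_density (B \<theta>))"
proof -
  interpret prob_space M by fact
  note A_borel[measurable]
  have l: "0 < B \<theta>" using assms B_pos by simp
  have le: "prob {\<omega> \<in> space M. X \<omega> \<le> x} = family_cdf a b A B \<theta> x" for x
    using law[of x] by (simp add: cdf_def measure_distr vimage_def Int_def conj_commute)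
  have "prob {\<omega> \<in> space M. X \<omega> \<le> a} = 0"
    using a_less_b A_left by (simp add: le family_cdf_def)
  then have gt_a: "AE \<omega> in M. a < X \<omega>"
    by (subst (asm) prob_eq_0) (auto simp: not_le)
  \<comment> \<open>The mass below \<open>b\<close> dominates the distribution function at any
    \<open>c\<close> below \<open>b\<close>. Choosing \<open>A c = t\<close> and letting
    \<open>t\<close> tend to infinity excludes an atom at \<open>b\<close> and covers infinite
    \<open>b\<close> as well.\<close>
  have "1 \<le> prob {\<omega> \<in> space M. ereal (X \<omega>) < b}"
  proof (rule tendsto_upperbound)
    show "((\<lambda>t. 1 - exp (- (B \<theta> * t))) \<longlongrightarrow> 1) at_top" using l by real_asymp
    show "\<forall>\<^sub>F t in at_top. 1 - exp (- (B \<theta> * t)) \<le> prob {\<omega> \<in> space M. ereal (X \<omega>) < b}"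
      using eventually_ge_at_top[of 0]
    proof eventually_elim
      case (elim t)
      then obtain c where c: "a \<le> c" "ereal c < b" "A c = t" by (rule A_surj)
      have "prob {\<omega> \<in> space M. X \<omega> \<le> c} \<le> prob {\<omega> \<in> space M. ereal (X \<omega>) < b}"
        using c by (intro finite_measure_mono) (auto intro: le_less_trans[of _ "ereal c"])
      then show ?case using c by (simp add: le family_cdf_def)
    qed
  qed simp
  then have "AE \<omega> in M. ereal (X \<omega>) < b"
    using prob_le_1 by (subst (asm) antisym_conv) (auto simp: prob_Collect_eq_1)
  with gt_a show AE: "AE \<omega> in M. a < X \<omega> \<and> ereal (X \<omega>) < b" by eventually_elim simp
  have A_le: "A x \<le> A y" if "x \<le> y" "a \<le> x" "ereal y < b" for x y
    using that by (intro mono_onD[OF A_mono]) (auto intro: le_less_trans[of _ "ereal y"])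
  \<comment> \<open>On a flat stretch at level \<open>t\<close>,
    \<open>A (X \<omega>) \<le> t\<close> does not give \<open>X \<omega> \<le> c\<close> for a
    chosen \<open>c\<close> with \<open>A c = t\<close>. Such a \<open>c\<close> yields the lower
    bound only; for the upper bound take \<open>A c = t + e\<close>, where
    \<open>A (X \<omega>) \<le> t\<close> does force \<open>X \<omega> \<le> c\<close>, and let
    \<open>e\<close> tend to 0.\<close>
  have "prob {\<omega> \<in> space M. A (X \<omega>) \<le> t} = 1 - exp (- t * B \<theta>)" if t: "0 \<le> t" for t
  proof (rule antisym)
    obtain c where c: "a \<le> c" "ereal c < b" "A c = t" using t by (rule A_surj)
    have "prob {\<omega> \<in> space M. X \<omega> \<le> c} \<le> prob {\<omega> \<in> space M. A (X \<omega>) \<le> t}"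
      using AE by (intro finite_measure_mono_AE) (auto simp: c(2) A_le simp flip: c(3))
    then show "1 - exp (- t * B \<theta>) \<le> prob {\<omega> \<in> space M. A (X \<omega>) \<le> t}"
      using c by (simp add: le family_cdf_def mult.commute)
  next
    show "prob {\<omega> \<in> space M. A (X \<omega>) \<le> t} \<le> 1 - exp (- t * B \<theta>)"
    proof (rule tendsto_lowerbound)
      have "((\<lambda>e. 1 - exp (- (t + e) * B \<theta>)) \<longlongrightarrow> 1 - exp (- (t + 0) * B \<theta>)) (at_right 0)"
        by (intro tendsto_intros)
      then show "((\<lambda>e. 1 - exp (- (t + e) * B \<theta>)) \<longlongrightarrow> 1 - exp (- t * B \<theta>)) (at_right 0)" by simp
      show "\<forall>\<^sub>F e in at_right 0. prob {\<omega> \<in> space M. A (X \<omega>) \<le> t} \<le> 1 - exp (- (t + e) * B \<theta>)"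
        using eventually_at_right_less[of "0 :: real"]
      proof eventually_elim
        case (elim e)
        then obtain c where c: "a \<le> c" "ereal c < b" "A c = t + e" using t A_surj[of "t + e"] by auto
        have "prob {\<omega> \<in> space M. A (X \<omega>) \<le> t} \<le> prob {\<omega> \<in> space M. X \<omega> \<le> c}"
        proof (rule finite_measure_mono_AE)
          show "AE \<omega> in M. \<omega> \<in> {\<omega> \<in> space M. A (X \<omega>) \<le> t} \<longrightarrow> \<omega> \<in> {\<omega> \<in> space M. X \<omega> \<le> c}"
            using AE
          proof eventually_elim
            case (elim \<omega>)
            then show ?case using A_le[of c "X \<omega>"] c \<open>0 < e\<close> by force
          qed
        qed simp
        moreover have "- (B \<theta> * (t + e)) = - (t + e) * B \<theta>" by (simp add: algebra_simps)
        ultimately show ?case using c by (simp add: le family_cdf_def del: minus_add_distrib)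
      qed
    qed simp
  qed
  then have "distributed M lborel (\<lambda>\<omega>. A (X \<omega>)) (exponential_density (B \<theta>))"
    by (subst exponential_distributed_iff[OF l]) simp
  then show "distr M borel (\<lambda>\<omega>. A (X \<omega>)) = density lborel (exponential_density (B \<theta>))"
    using distributed_distr_eq_density by (metis distr_cong sets_lborel)
qed

section \<open>Equality in law of the statistics and of the estimators\<close>

lemma identically_distributed_compose:
  assumes "identically_distributed M U N V" and [measurable]: "g \<in> borel_measurable borel"
  shows "identically_distributed M (\<lambda>\<omega>. g (U \<omega>)) N (\<lambda>\<omega>. g (V \<omega>))"
proof -
  have [measurable]: "U \<in> borel_measurable M" "V \<in> borel_measurable N"
    and eq: "distr M borel U = distr N borel V"
    using assms(1) by (auto simp: identically_distributed_def)
  have "distr (distr M borel U) borel g = distr (distr N borel V) borel g" by (simp add: eq)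
  then show ?thesis by (simp add: identically_distributed_def distr_distr comp_def)
qed

lemma identically_distributed_imp_MSE_eq:
  assumes "identically_distributed M U N V"
  shows "MSE M U t = MSE N V t"
proof -
  have [measurable]: "U \<in> borel_measurable M" "V \<in> borel_measurable N"
    and eq: "distr M borel U = distr N borel V"
    using assms(1) by (auto simp: identically_distributed_def)
  have "MSE M U t = (\<integral>\<^sup>+x. ennreal ((x - t)\<^sup>2) \<partial>distr M borel U)"
    unfolding MSE_def by (simp add: nn_integral_distr)
  also have "\<dots> = MSE N V t"
    unfolding MSE_def eq by (simp add: nn_integral_distr)
  finally show ?thesis .
qed

lemma upper_record_order_preserving:
  assumes "\<And>i j. i < j \<Longrightarrow> A (y i) < A (y j) \<longleftrightarrow> y i < (y j :: real)"
  shows "A (upper_record y k) = upper_record (\<lambda>i. A (y i)) k"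
proof -
  have "record_times (\<lambda>i. A (y i)) = record_times y"
    using assms by (auto simp: record_times_def)
  then show ?thesis by (simp add: upper_record_def)
qed

lemma (in exp_family_first_type) identically_distributed_statistics:
  assumes \<theta>: "\<theta> \<in> \<Theta>" and n: "1 \<le> n"
    and X: "iid_with_cdf M {..<n} X (family_cdf a b A B \<theta>)"
    and Y: "iid_with_cdf N UNIV Y (family_cdf a b A B \<theta>)"
  shows "identically_distributed M (\<lambda>\<omega>. \<Sum>i<n. A (X i \<omega>))
    N (\<lambda>\<omega>. A (upper_record (\<lambda>i. Y i \<omega>) (n - 1)))"
proof -
  define \<nu> where "\<nu> = density lborel (exponential_density (B \<theta>))"
  have l: "0 < B \<theta>" using \<theta> B_pos by simp
  interpret M: prob_space M using X by (simp add: iid_with_cdf_def)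
  interpret N: prob_space N using Y by (simp add: iid_with_cdf_def)
  note A_borel[measurable]
  have indX: "M.indep_vars (\<lambda>_. borel) X {..<n}" and indY: "N.indep_vars (\<lambda>_. borel) Y UNIV"
    and cdfX: "\<And>i x. i < n \<Longrightarrow> cdf (distr M borel (X i)) x = family_cdf a b A B \<theta> x"
    and cdfY: "\<And>i x. cdf (distr N borel (Y i)) x = family_cdf a b A B \<theta> x"
    using X Y by (auto simp: iid_with_cdf_def)
  have [measurable]: "i < n \<Longrightarrow> X i \<in> borel_measurable M" "Y i \<in> borel_measurable N" for i
    using indX indY by (auto simp: M.indep_vars_def N.indep_vars_def)
  have lawX: "distr M borel (\<lambda>\<omega>. A (X i \<omega>)) = \<nu>" if "i < n" for i
    unfolding \<nu>_def using that cdfX by (intro distr_A_exponential[OF \<theta> M.prob_space_axioms]) auto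
  have lawY: "distr N borel (\<lambda>\<omega>. A (Y i \<omega>)) = \<nu>" for i
    unfolding \<nu>_def using cdfY by (intro distr_A_exponential[OF \<theta> N.prob_space_axioms]) auto
  have indAX: "M.indep_vars (\<lambda>_. borel) (\<lambda>i \<omega>. A (X i \<omega>)) {..<n}"
    using indX by (rule M.indep_vars_compose2) simp
  have indAY: "N.indep_vars (\<lambda>_. borel) (\<lambda>i \<omega>. A (Y i \<omega>)) UNIV"
    using indY by (rule N.indep_vars_compose2) simp
  have meas[measurable]: "(\<lambda>\<omega>. upper_record (\<lambda>i. Y i \<omega>) (n - 1)) \<in> borel_measurable N"
      "(\<lambda>\<omega>. upper_record (\<lambda>i. A (Y i \<omega>)) (n - 1)) \<in> borel_measurable N"
    by (rule borel_measurable_upper_record; measurable)+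
  have "emeasure \<nu> {x} = 0" for x
    unfolding \<nu>_def by (subst emeasure_density) (auto simp: nn_integral_0_iff_AE AE_lborel_singleton
        intro!: eventually_mono[OF AE_lborel_singleton[of x]])
  then have "AE \<omega> in N. A (Y i \<omega>) \<noteq> A (Y j \<omega>)" if "i \<noteq> j" for i j
    using that by (intro N.indep_var_AE_neq N.indep_vars_imp_indep_var[OF indAY]) (auto simp: lawY)
  then have neq: "AE \<omega> in N. \<forall>i j. i < j \<longrightarrow> A (Y i \<omega>) \<noteq> A (Y j \<omega>)"
    by (simp add: AE_all_countable)
  have supp: "AE \<omega> in N. \<forall>i. a < Y i \<omega> \<and> ereal (Y i \<omega>) < b"
    unfolding AE_all_countable using cdfY
    by (intro allI AE_in_support[OF \<theta> N.prob_space_axioms]) auto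
  have "AE \<omega> in N. A (upper_record (\<lambda>i. Y i \<omega>) (n - 1)) = upper_record (\<lambda>i. A (Y i \<omega>)) (n - 1)"
    using neq supp
  proof eventually_elim
    case (elim \<omega>)
    \<comment> \<open>Although \<open>A\<close> need not be strictly increasing, monotonicity on the
      support and the absence of ties among the values \<open>A (Y i \<omega>)\<close> make it
      preserve strict order on the observations.\<close>
    have "A (Y i \<omega>) \<le> A (Y j \<omega>)" if "Y i \<omega> \<le> Y j \<omega>" for i j
      using elim(2) that by (intro mono_onD[OF A_mono]) (auto intro: less_imp_le)
    then have "A (Y i \<omega>) < A (Y j \<omega>) \<longleftrightarrow> Y i \<omega> < Y j \<omega>" if "i < j" for i j
      using that elim(1) by (metis leD le_less not_le)
    then show ?case by (rule upper_record_order_preserving)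
  qed
  then have "distr N borel (\<lambda>\<omega>. A (upper_record (\<lambda>i. Y i \<omega>) (n - 1))) =
      distr N borel (\<lambda>\<omega>. upper_record (\<lambda>i. A (Y i \<omega>)) (n - 1))"
    by (intro distr_cong_AE refl measurable_compose[OF meas(1) A_borel] meas(2)) auto
  \<comment> \<open>Records are numbered from 0, so the one with index \<open>n - 1\<close> matches
    a sum of \<open>Suc (n - 1) = n\<close> terms.\<close>
  also have "\<dots> = distr (stream_space \<nu>) borel (\<lambda>s. \<Sum>i<Suc (n - 1). s !! i)"
    using N.distr_upper_record_exponential[OF l indAY] lawY by (simp add: \<nu>_def del: sum.lessThan_Suc)
  also have "\<dots> = distr M borel (\<lambda>\<omega>. \<Sum>i<n. A (X i \<omega>))"
    using M.distr_sum_indep_vars_stream[OF indAX _ lawX] n by simp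
  finally show ?thesis
    using measurable_compose[OF meas(1) A_borel] by (simp add: identically_distributed_def)
qed

lemma (in exp_family_first_type) borel_measurable_inv_B: "inv_into \<Theta> B \<in> borel_measurable borel"
proof (rule borel_measurable_inv_into_interval[OF interval _ B_inj])
  obtain B' where "\<And>\<theta>. \<theta> \<in> \<Theta> \<Longrightarrow> (B has_real_derivative B' \<theta>) (at \<theta> within \<Theta>)"
    using B_diff2 by blast
  then show "continuous_on \<Theta> B" by (rule DERIV_continuous_on)
qed

theorem theorem1:
  fixes a :: real and b :: ereal and A B :: "real \<Rightarrow> real"
    and \<Theta> :: "real set" and \<theta> :: real and n :: nat
    and M :: "'a measure" and X :: "nat \<Rightarrow> 'a \<Rightarrow> real"
    and N :: "'b measure" and Y :: "nat \<Rightarrow> 'b \<Rightarrow> real"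
  assumes "exp_family_first_type a b A \<Theta> B"
    and "\<theta> \<in> \<Theta>"
    and "1 \<le> n"
    and "iid_with_cdf M {..<n} X (family_cdf a b A B \<theta>)"
    and "iid_with_cdf N UNIV Y (family_cdf a b A B \<theta>)"
    and "AE \<omega> in M. real n / (\<Sum>i<n. A (X i \<omega>)) \<in> B ` \<Theta>"
    and "AE \<omega> in N. real n / A (upper_record (\<lambda>i. Y i \<omega>) (n - 1)) \<in> B ` \<Theta>"
  shows "identically_distributed
           M (\<lambda>\<omega>. sample_mle A \<Theta> B n (\<lambda>i. X i \<omega>))
           N (\<lambda>\<omega>. record_mle A \<Theta> B n (upper_record (\<lambda>i. Y i \<omega>))) \<and>
         (\<forall>g\<in>borel_measurable borel.
           identically_distributed
             M (\<lambda>\<omega>. g (sample_mle A \<Theta> B n (\<lambda>i. X i \<omega>)))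
             N (\<lambda>\<omega>. g (record_mle A \<Theta> B n (upper_record (\<lambda>i. Y i \<omega>)))) \<and>
           MSE M (\<lambda>\<omega>. g (sample_mle A \<Theta> B n (\<lambda>i. X i \<omega>))) (g \<theta>) =
           MSE N (\<lambda>\<omega>. g (record_mle A \<Theta> B n (upper_record (\<lambda>i. Y i \<omega>)))) (g \<theta>))"
proof -
  interpret exp_family_first_type a b A \<Theta> B by fact
  note borel_measurable_inv_B[measurable]
  have "(\<lambda>s. inv_into \<Theta> B (real n / s)) \<in> borel_measurable borel" by measurable
  from identically_distributed_compose[OF identically_distributed_statistics[OF assms(2-5)] this]
  have "identically_distributed
           M (\<lambda>\<omega>. sample_mle A \<Theta> B n (\<lambda>i. X i \<omega>))
           N (\<lambda>\<omega>. record_mle A \<Theta> B n (upper_record (\<lambda>i. Y i \<omega>)))"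
    by (simp add: sample_mle_def record_mle_def)
  then show ?thesis
    by (auto intro: identically_distributed_compose identically_distributed_imp_MSE_eq)
qed

end
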